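(* For $N\in\mathbb{Z}^d$, $N>\mathbf 0$, let $D_N(x)=\sum_{-N\le k\le N}e^{2\pi i\langle k,x\rangle}$, and for $n\in\mathbb{N}$ let $$F_n(x)=\sum_{k\in\mathbb{Z}^d,\ \|k\|_\infty<n}\left(1-\frac{\|k\|_\infty}{n}\right)e^{2\pi i\langle k,x\rangle}.$$ Then $$\mathrm{UP}^{\mathbb{T}^d}_{GG}(D_N)\to\infty,\quad \|N\|\to\infty,\qquad\text{and}\qquad \mathrm{UP}^{\mathbb{T}^d}_{GG}(F_n)\to\frac{(d+1)^2(d+2)^2}{6d(d+3)(d+4)},\quad n\to\infty.$$
   Context: $\mathbb{T}^d=\mathbb{R}^d/\mathbb{Z}^d$; $\|\cdot\|$ is the Euclidean norm on $\mathbb{R}^d$, $\|k\|_\infty=\max_j|k_j|$, $\|f\|_{\mathbb{T}^d}^2=\int_{\mathbb{T}^d}|f|^2dx$, and $e_1,\dots,e_d$ is the standard basis of $\mathbb{R}^d$. For $x,y\in\mathbb{R}^d$, $x\ge y$ means $x_j\ge y_j$ for all $j$, and $x>y$ means $x\ge y$ and $x\ne y$; sums over $-N\le k\le N$ run over $k\in\mathbb{Z}^d$. The Goh–Goodman uncertainty product of $f\in H^1(\mathbb{T}^d)$ with Fourier coefficients $c_k=\int_{\mathbb{T}^d} f(x)e^{-2\pi i\langle k,x\rangle}dx$ is $$\mathrm{UP}^{\mathbb{T}^d}_{GG}(f)=\frac{\sum_{j=1}^d\left(\|f\|_{\mathbb{T}^d}^4-\left|\sum_{k\in\mathbb{Z}^d}c_{k-e_j}\overline{c_k}\right|^2\right)}{\left(\sum_{j=1}^d\left|\sum_{k\in\mathbb{Z}^d}c_{k-e_j}\overline{c_k}\right|\right)^2}\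 \sum_{j=1}^d\left(\frac{\sum_{k\in\mathbb{Z}^d}k_j^2|c_k|^2}{\|f\|_{\mathbb{T}^d}^2}-\left(\frac{\sum_{k\in\mathbb{Z}^d}k_j|c_k|^2}{\|f\|_{\mathbb{T}^d}^2}\right)^2\right),$$ defined whenever the first denominator is non-zero. *)

theory Defs
  imports "HOL-Analysis.Analysis" "HOL-Library.Going_To_Filter"
begin

text \<open>
  The dimension \<open>d\<close> is the cardinality of the finite index type \<open>'d\<close>. Functions on the torus are
  functions on \<open>real ^ 'd\<close> that are periodic with respect to the integer lattice, and integrals
  over the torus are Lebesgue integrals over the fundamental domain \<open>cbox 0 1\<close>.
\<close>

definition real_vec :: "int ^ 'd \<Rightarrow> real ^ 'd" where
  "real_vec k = (\<chi> j. real_of_int (k $ j))"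

definition torus_char :: "int ^ 'd \<Rightarrow> real ^ 'd \<Rightarrow> complex" where
  "torus_char k x = exp (2 * of_real pi * \<i> * of_real (real_vec k \<bullet> x))"

definition torus_periodic :: "(real ^ 'd \<Rightarrow> complex) \<Rightarrow> bool" where
  "torus_periodic f \<longleftrightarrow> (\<forall>x k. f (x + real_vec k) = f x)"

definition torus_L2 :: "(real ^ 'd \<Rightarrow> complex) set" where
  "torus_L2 = {f. torus_periodic f \<and> set_borel_measurable lebesgue (cbox 0 1) f \<and>
                  set_integrable lebesgue (cbox 0 1) (\<lambda>x. (cmod (f x))\<^sup>2)}"

definition torus_norm :: "(real ^ 'd \<Rightarrow> complex) \<Rightarrow> real" where
  "torus_norm f = sqrt (LINT x:cbox 0 1|lebesgue. (cmod (f x))\<^sup>2)"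

definition fourier_coeff :: "(real ^ 'd \<Rightarrow> complex) \<Rightarrow> int ^ 'd \<Rightarrow> complex" where
  "fourier_coeff f k =
     (LINT x:cbox 0 1|lebesgue. f x * exp (- (2 * of_real pi * \<i> * of_real (real_vec k \<bullet> x))))"

definition torus_H1 :: "(real ^ 'd \<Rightarrow> complex) set" where
  "torus_H1 = {f \<in> torus_L2.
     (\<lambda>k. (norm (real_vec k))\<^sup>2 * (cmod (fourier_coeff f k))\<^sup>2) summable_on UNIV}"

definition shift_corr :: "(real ^ 'd \<Rightarrow> complex) \<Rightarrow> 'd \<Rightarrow> complex" where
  "shift_corr f j = (\<Sum>\<^sub>\<infinity>k. fourier_coeff f (k - axis j 1) * cnj (fourier_coeff f k))"

definition UP_GG_defined :: "(real ^ 'd \<Rightarrow> complex) \<Rightarrow> bool" where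
  "UP_GG_defined f \<longleftrightarrow> f \<in> torus_H1 \<and> (\<Sum>j\<in>UNIV. cmod (shift_corr f j))\<^sup>2 \<noteq> 0"

text \<open>
  Outside its domain of definition the uncertainty product is an unspecified real number, so
  a limit statement about it can only be proved if it is eventually defined. On the domain, all the
  infinite sums below converge absolutely and \<open>torus_norm f\<close> is non-zero.
\<close>

definition UP_GG :: "(real ^ 'd \<Rightarrow> complex) \<Rightarrow> real" where
  "UP_GG f =
     (if UP_GG_defined f then
        (\<Sum>j\<in>UNIV. torus_norm f ^ 4 - (cmod (shift_corr f j))\<^sup>2)
          / (\<Sum>j\<in>UNIV. cmod (shift_corr f j))\<^sup>2
        * (\<Sum>j\<in>UNIV.
             (\<Sum>\<^sub>\<infinity>k. (real_of_int (k $ j))\<^sup>2 * (cmod (fourier_coeff f k))\<^sup>2) / (torus_norm f)\<^sup>2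
             - ((\<Sum>\<^sub>\<infinity>k. real_of_int (k $ j) * (cmod (fourier_coeff f k))\<^sup>2) / (torus_norm f)\<^sup>2)\<^sup>2)
      else undefined)"

definition dirichlet_kernel :: "int ^ 'd \<Rightarrow> real ^ 'd \<Rightarrow> complex" where
  "dirichlet_kernel N x = (\<Sum>k\<in>{-N..N}. torus_char k x)"

definition fejer_kernel :: "nat \<Rightarrow> real ^ 'd \<Rightarrow> complex" where
  "fejer_kernel n x =
     (\<Sum>k\<in>{k. infnorm (real_vec k) < real n}.
        of_real (1 - infnorm (real_vec k) / real n) * torus_char k x)"

end

theory Submission
  imports Defs "HOL-Real_Asymp.Real_Asymp"
begin

text \<open>
  Write \<open>S\<close> for the sum of the squared coefficients, \<open>A\<^sub>j\<close> for the \<open>j\<close>-th shift correlation and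
  \<open>Q\<^sub>j\<close> for the second moment in direction \<open>j\<close>. For the Dirichlet kernel these factorise over the
  coordinates: \<open>A\<^sub>j / S = 2N\<^sub>j / (2N\<^sub>j + 1)\<close> and \<open>Q\<^sub>j / S = N\<^sub>j (N\<^sub>j + 1) / 3\<close>, so the first factor of the
  uncertainty product decays at most like \<open>1 / N\<^sub>i\<close> while the second grows like \<open>N\<^sub>i\<^sup>2\<close>, for each \<open>i\<close>.

  The kernel \<open>F\<^sub>n\<close> is the mean of the Dirichlet kernels of the cubes \<open>[-m, m]\<^sup>d\<close>, \<open>m < n\<close>. Cubes are
  nested, so all quadratic sums reduce to counts in the smaller of two cubes, the only correction
  being that a cube loses a slice of \<open>(2m + 1)\<^bsup>d-1\<^esup>\<close> points when intersected with its own unit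
  shift, but nothing when intersected with a shifted larger cube. This expresses the uncertainty
  product through the sums of \<open>(2m + 1)\<^sup>p\<close> over \<open>m < n\<close>, which are asymptotic to \<open>2\<^sup>p n\<^bsup>p+1\<^esup> / (p + 1)\<close>.
\<close>

section \<open>Trigonometric polynomials\<close>

lemma has_bochner_integral_exp_unit_interval:
  assumes "a \<in> \<int>"
  shows "has_bochner_integral lborel
    (\<lambda>t. indicator {0..1} t *\<^sub>R exp (2 * of_real pi * \<i> * of_real (a * t))) (of_bool (a = 0) :: complex)"
proof (cases "a = 0")
  case True
  then show ?thesis
    using has_bochner_integral_FTC_Icc[of 0 1 complex_of_real "\<lambda>_. 1"]
    by (auto simp: has_vector_derivative_def has_derivative_of_real scaleR_conv_of_real)
next
  case False
  define z where "z = 2 * complex_of_real pi * \<i> * of_real a"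
  have z: "z \<noteq> 0" using False by (simp add: z_def)
  have "((\<lambda>t. exp (z * of_real t) / z) has_vector_derivative exp (z * of_real t)) (at t within {0..1})" for t
    using z by (auto intro!: derivative_eq_intros has_vector_derivative_real_field)
  moreover have "continuous_on {0..1} (\<lambda>t. exp (z * of_real t))"
    by (intro continuous_intros)
  ultimately have "has_bochner_integral lborel (\<lambda>t. indicator {0..1} t *\<^sub>R exp (z * of_real t))
      (exp (z * of_real 1) / z - exp (z * of_real 0) / z)"
    by (intro has_bochner_integral_FTC_Icc) auto
  \<comment> \<open>This is where integrality of \<open>a\<close> enters: the antiderivative takes
    the same value at both endpoints.\<close>
  moreover have "exp z = 1"
    using assms by (auto simp: z_def exp_eq_1 Ints_def)
  ultimately show ?thesis
    using False by (simp add: z_def mult_ac)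
qed

lemma continuous_on_torus_char [continuous_intros]: "continuous_on S (torus_char k)"
  unfolding torus_char_def by (intro continuous_intros)

lemma real_vec_add: "real_vec (k + l) = real_vec k + real_vec l"
  and real_vec_minus: "real_vec (- k) = - real_vec k"
  by (simp_all add: real_vec_def vec_eq_iff)

lemma real_vec_eq_0_iff: "real_vec k = 0 \<longleftrightarrow> k = 0"
  by (simp add: real_vec_def vec_eq_iff)

lemma torus_char_add: "torus_char (k + l) x = torus_char k x * torus_char l x"
  by (simp add: torus_char_def real_vec_add inner_add_left ring_distribs exp_add)

lemma cnj_torus_char: "cnj (torus_char k x) = torus_char (- k) x"
  by (simp add: torus_char_def real_vec_minus exp_cnj)

lemma exp_minus_torus_char: "exp (- (2 * of_real pi * \<i> * of_real (real_vec k \<bullet> x))) = torus_char (- k) x"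
  by (simp add: torus_char_def real_vec_minus)

lemma torus_periodic_torus_char: "torus_char k (x + real_vec l) = torus_char k x"
proof -
  have "real_vec k \<bullet> real_vec l = of_int (\<Sum>j\<in>UNIV. k $ j * l $ j)"
    by (simp add: real_vec_def inner_vec_def)
  then have "exp (2 * of_real pi * \<i> * of_real (real_vec k \<bullet> real_vec l)) = 1"
    unfolding exp_eq_1 by (simp del: of_int_sum)
  then show ?thesis
    by (simp add: torus_char_def inner_add_right ring_distribs exp_add)
qed

lemma set_integrable_cbox_continuous:
  fixes f :: "real ^ 'd \<Rightarrow> complex"
  assumes "continuous_on UNIV f"
  shows "set_integrable lebesgue (cbox 0 1) f"
  using assms by (intro absolutely_integrable_continuous) (auto intro: continuous_on_subset)

text \<open>Both the indicator of the unit cube and the character factor over the coordinates, so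
  Fubini reduces the integral to one-dimensional ones; a single non-zero frequency annihilates the
  product.\<close>

lemma integral_torus_char:
  fixes k :: "int ^ 'd"
  shows "(LINT x:cbox 0 1|lebesgue. torus_char k x) = of_bool (k = 0)"
proof -
  let ?B = "Basis :: (real ^ 'd) set"
  define g :: "real ^ 'd \<Rightarrow> real \<Rightarrow> complex" where
    "g b t = indicator {0..1} t *\<^sub>R exp (2 * of_real pi * \<i> * of_real ((real_vec k \<bullet> b) * t))" for b t
  have g: "has_bochner_integral lborel (g b) (of_bool (real_vec k \<bullet> b = 0))" if "b \<in> ?B" for b
  proof -
    have "real_vec k \<bullet> b \<in> \<int>"
      using that by (auto simp: Basis_vec_def inner_axis real_vec_def)
    then show ?thesis
      unfolding g_def by (rule has_bochner_integral_exp_unit_interval)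
  qed
  have g_borel [measurable]: "g b \<in> borel_measurable borel" for b
    unfolding g_def
    by (intro borel_measurable_scaleR borel_measurable_indicator borel_measurable_continuous_onI
        continuous_intros) auto
  have prod: "indicator (cbox 0 1) x *\<^sub>R torus_char k x = (\<Prod>b\<in>?B. g b (x \<bullet> b))" for x
  proof -
    have "indicator (cbox 0 1) x = (\<Prod>b\<in>?B. indicator {0..1} (x \<bullet> b) :: real)"
    proof (cases "x \<in> cbox 0 1")
      case True
      then have "x \<bullet> b \<in> {0..1}" if "b \<in> ?B" for b
        using that by (auto simp: mem_box Basis_vec_def inner_axis)
      then show ?thesis
        using True by simp
    next
      case False
      then have "\<exists>b\<in>?B. x \<bullet> b \<notin> {0..1}"
        by (force simp: mem_box Basis_vec_def inner_axis)
      then show ?thesis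
        using False by (subst prod_zero) (auto simp: indicator_eq_0_iff)
    qed
    moreover have "torus_char k x =
        (\<Prod>b\<in>?B. exp (2 * of_real pi * \<i> * of_real ((real_vec k \<bullet> b) * (x \<bullet> b))))"
      unfolding torus_char_def
      by (subst euclidean_inner) (simp add: exp_sum sum_distrib_left)
    ultimately show ?thesis
      by (simp add: g_def scaleR_conv_of_real prod.distrib)
  qed
  interpret product_sigma_finite "\<lambda>_. lborel :: real measure" ..
  \<comment> \<open>The integrand is Borel, so the completed measure may be replaced by
    \<open>lborel\<close>, which \<open>lborel_eq\<close> then presents as the image of a product
    measure.\<close>
  have "(LINT x:cbox 0 1|lebesgue. torus_char k x) = (\<integral>x. (\<Prod>b\<in>?B. g b (x \<bullet> b)) \<partial>lborel)"
    unfolding set_lebesgue_integral_def prod by (rule integral_completion) measurable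
  also have "\<dots> = (\<integral>f. (\<Prod>b\<in>?B. g b (f b)) \<partial>(\<Pi>\<^sub>M b\<in>?B. lborel))"
    by (subst lborel_eq, subst integral_distr) (auto intro!: Bochner_Integration.integral_cong prod.cong)
  also have "\<dots> = (\<Prod>b\<in>?B. integral\<^sup>L lborel (g b))"
    using g by (intro product_integral_prod) (auto dest: has_bochner_integral_iff[THEN iffD1])
  also have "\<dots> = (\<Prod>b\<in>?B. of_bool (real_vec k \<bullet> b = 0))"
    by (intro prod.cong refl has_bochner_integral_integral_eq g)
  also have "\<dots> = of_bool (k = 0)"
    using euclidean_all_zero_iff[of "real_vec k"]
    by (auto simp: real_vec_eq_0_iff intro!: prod_zero)
  finally show ?thesis .
qed

section \<open>The uncertainty product of a trigonometric polynomial in terms of its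
  coefficients\<close>

locale trig_polynomial =
  fixes K :: "(int ^ 'd) set" and c :: "int ^ 'd \<Rightarrow> real"
  assumes finite_K: "finite K" and outside: "k \<notin> K \<Longrightarrow> c k = 0"
begin

text \<open>\<open>K\<close> only has to contain the support of \<open>c\<close>, so a whole box can
  be used even when coefficients on its boundary vanish.\<close>

definition poly :: "real ^ 'd \<Rightarrow> complex" where
  "poly x = (\<Sum>k\<in>K. of_real (c k) * torus_char k x)"

lemma continuous_on_poly [continuous_intros]: "continuous_on S poly"
  unfolding poly_def by (intro continuous_intros)

lemma fourier_coeff_poly: "fourier_coeff poly l = of_real (c l)"
proof -
  have *: "poly x * exp (- (2 * of_real pi * \<i> * of_real (real_vec l \<bullet> x)))
      = (\<Sum>k\<in>K. of_real (c k) * torus_char (k - l) x)" for x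
    unfolding exp_minus_torus_char
    by (simp add: poly_def sum_distrib_right mult.assoc flip: torus_char_add)
  have "fourier_coeff poly l = (\<Sum>k\<in>K. LINT x:cbox 0 1|lebesgue. of_real (c k) * torus_char (k - l) x)"
    unfolding fourier_coeff_def * set_lebesgue_integral_def scaleR_sum_right
    by (intro Bochner_Integration.integral_sum
        set_integrable_cbox_continuous[unfolded set_integrable_def] continuous_intros)
  also have "\<dots> = (\<Sum>k\<in>K. of_real (c k) * of_bool (k = l))"
    by (simp add: integral_torus_char)
  also have "\<dots> = of_real (c l)"
    using finite_K outside by (simp add: of_bool_def if_distrib sum.delta cong: if_cong)
  finally show ?thesis .
qed

lemma torus_norm_poly: "(torus_norm poly)\<^sup>2 = (\<Sum>k\<in>K. (c k)\<^sup>2)"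
proof -
  \<comment> \<open>Only the conjugate factor is expanded; the integrals that remain are the Fourier
    coefficients already computed.\<close>
  have *: "complex_of_real ((cmod (poly x))\<^sup>2)
      = (\<Sum>l\<in>K. of_real (c l) * (poly x * exp (- (2 * of_real pi * \<i> * of_real (real_vec l \<bullet> x)))))" for x
    unfolding complex_norm_square exp_minus_torus_char
    by (simp add: poly_def[of x] cnj_torus_char sum_distrib_left sum_distrib_right mult_ac)
  have "complex_of_real (LINT x:cbox 0 1|lebesgue. (cmod (poly x))\<^sup>2)
      = (LINT x:cbox 0 1|lebesgue. complex_of_real ((cmod (poly x))\<^sup>2))"
    by (rule set_integral_complex_of_real[symmetric])
  also have "\<dots> = (\<Sum>l\<in>K. LINT x:cbox 0 1|lebesgue.
       of_real (c l) * (poly x * exp (- (2 * of_real pi * \<i> * of_real (real_vec l \<bullet> x)))))"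
    unfolding * set_lebesgue_integral_def scaleR_sum_right
    by (intro Bochner_Integration.integral_sum
        set_integrable_cbox_continuous[unfolded set_integrable_def] continuous_intros)
  also have "\<dots> = of_real (\<Sum>k\<in>K. (c k)\<^sup>2)"
    by (simp add: fourier_coeff_poly[unfolded fourier_coeff_def] power2_eq_square)
  finally have "(LINT x:cbox 0 1|lebesgue. (cmod (poly x))\<^sup>2) = (\<Sum>k\<in>K. (c k)\<^sup>2)"
    by (simp only: of_real_eq_iff)
  then show ?thesis
    by (simp add: torus_norm_def sum_nonneg)
qed

lemma infsum_coeff:
  fixes g :: "int ^ 'd \<Rightarrow> 'a :: {comm_monoid_add, t2_space}"
  assumes "\<And>k. c k = 0 \<Longrightarrow> g k = 0"
  shows "infsum g UNIV = sum g K"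
  using finite_K outside assms by (subst infsum_cong_neutral[of K UNIV g g]) auto

lemma poly_in_H1: "poly \<in> torus_H1"
proof -
  have "set_borel_measurable lebesgue (cbox 0 1) poly"
    using set_integrable_cbox_continuous[OF continuous_on_poly]
    unfolding set_borel_measurable_def set_integrable_def by (rule borel_measurable_integrable)
  moreover have "set_integrable lebesgue (cbox 0 1) (\<lambda>x. (cmod (poly x))\<^sup>2)"
    by (intro absolutely_integrable_continuous continuous_intros)
  moreover have "torus_periodic poly"
    by (simp add: torus_periodic_def poly_def torus_periodic_torus_char)
  moreover have "(\<lambda>k. (norm (real_vec k))\<^sup>2 * (cmod (fourier_coeff poly k))\<^sup>2) summable_on UNIV"
    using finite_K outside
    by (subst summable_on_cong_neutral[where S = UNIV and T = K
          and g = "\<lambda>k. (norm (real_vec k))\<^sup>2 * (cmod (fourier_coeff poly k))\<^sup>2"])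
      (auto simp: fourier_coeff_poly)
  ultimately show ?thesis
    by (simp add: torus_H1_def torus_L2_def)
qed

lemma shift_corr_poly: "shift_corr poly j = of_real (\<Sum>k\<in>K. c (k - axis j 1) * c k)"
  unfolding shift_corr_def fourier_coeff_poly by (subst infsum_coeff) auto

text \<open>Nonnegativity removes the moduli from the shift correlations, evenness makes the first
  moments vanish, and the non-zero correlation sum puts \<open>poly\<close> into the domain of
  \<open>UP_GG\<close>.\<close>

lemma UP_GG_poly:
  defines "S \<equiv> \<Sum>k\<in>K. (c k)\<^sup>2"
    and "A \<equiv> \<lambda>j. \<Sum>k\<in>K. c (k - axis j 1) * c k"
    and "Q \<equiv> \<lambda>j. \<Sum>k\<in>K. (of_int (k $ j))\<^sup>2 * (c k)\<^sup>2"
  assumes nonneg: "\<And>k. c k \<ge> 0" and even: "\<And>k. c (- k) = c k"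
    and A: "(\<Sum>j\<in>UNIV. A j) \<noteq> 0"
  shows "UP_GG poly = (\<Sum>j\<in>UNIV. S\<^sup>2 - (A j)\<^sup>2) / (\<Sum>j\<in>UNIV. A j)\<^sup>2 * (\<Sum>j\<in>UNIV. Q j / S)"
proof -
  have A_nonneg: "A j \<ge> 0" for j
    unfolding A_def by (intro sum_nonneg mult_nonneg_nonneg nonneg)
  then have cmod_A: "cmod (shift_corr poly j) = A j" for j
    by (simp only: shift_corr_poly norm_of_real A_def abs_of_nonneg)
  have "UP_GG_defined poly"
    using A by (simp add: UP_GG_defined_def poly_in_H1 cmod_A)
  moreover have "torus_norm poly ^ 4 = S\<^sup>2"
    unfolding S_def torus_norm_poly[symmetric] by simp
  moreover have "(\<Sum>\<^sub>\<infinity>k. (real_of_int (k $ j))\<^sup>2 * (cmod (fourier_coeff poly k))\<^sup>2) = Q j" for j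
    unfolding Q_def by (subst infsum_coeff) (auto simp: fourier_coeff_poly)
  moreover have "(\<Sum>\<^sub>\<infinity>k. real_of_int (k $ j) * (cmod (fourier_coeff poly k))\<^sup>2) = 0" for j
  proof -
    define g where "g = (\<lambda>k. real_of_int (k $ j) * (c k)\<^sup>2)"
    \<comment> \<open>Reflecting the sum over the whole lattice avoids any symmetry assumption on
      \<open>K\<close>.\<close>
    have "infsum g UNIV = infsum (\<lambda>k. g (- k)) UNIV"
      by (rule infsum_reindex_bij_betw[symmetric]) (rule bij_uminus)
    also have "\<dots> = - infsum g UNIV"
      by (simp add: g_def even infsum_uminus)
    finally have "infsum g UNIV = 0"
      by simp
    then show ?thesis
      by (simp add: g_def fourier_coeff_poly)
  qed
  ultimately show ?thesis
    by (simp add: UP_GG_def cmod_A torus_norm_poly S_def)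
qed

end

section \<open>Lattice points in boxes\<close>

lemma box_eq_image_PiE:
  "{a..b :: int ^ 'd} = vec_lambda ` (\<Pi>\<^sub>E j\<in>UNIV. {a $ j..b $ j})"
proof (intro equalityI subsetI)
  fix k assume "k \<in> {a..b}"
  then have "($) k \<in> (\<Pi>\<^sub>E j\<in>UNIV. {a $ j..b $ j})"
    by (auto simp: less_eq_vec_def)
  then show "k \<in> vec_lambda ` (\<Pi>\<^sub>E j\<in>UNIV. {a $ j..b $ j})"
    by (metis image_eqI vec_nth_inverse)
qed (auto simp: less_eq_vec_def PiE_iff)

lemma finite_box: "finite {a..b :: int ^ 'd}"
  unfolding box_eq_image_PiE by (intro finite_imageI finite_PiE) auto

lemma sum_box_prod:
  fixes f :: "'d :: finite \<Rightarrow> int \<Rightarrow> 'a :: comm_semiring_1"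
  shows "(\<Sum>k\<in>{a..b}. \<Prod>i\<in>UNIV. f i (k $ i)) = (\<Prod>i\<in>UNIV. \<Sum>x\<in>{a $ i..b $ i}. f i x)"
proof -
  have "inj_on vec_lambda (\<Pi>\<^sub>E j\<in>UNIV. {a $ j..b $ j})"
    by (auto intro!: inj_onI simp: vec_lambda_inject)
  then show ?thesis
    by (simp add: box_eq_image_PiE sum.reindex prod_sum_PiE)
qed

definition box_volume :: "int ^ 'd \<Rightarrow> real" where
  "box_volume N = (\<Prod>i\<in>UNIV. 2 * of_int (N $ i) + 1)"

text \<open>For \<open>N \<ge> 0\<close> this counts the lattice points in a cross-section of the
  box orthogonal to axis \<open>j\<close>.\<close>

definition slice_volume :: "'d \<Rightarrow> int ^ 'd \<Rightarrow> real" where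
  "slice_volume j N = (\<Prod>i\<in>UNIV - {j}. 2 * of_int (N $ i) + 1)"

lemma box_volume_eq_slice_volume: "box_volume N = slice_volume j N * (2 * of_int (N $ j) + 1)"
  by (simp add: box_volume_def slice_volume_def prod.remove[of UNIV j])

lemma card_box: "N \<ge> 0 \<Longrightarrow> real (card {-N..N}) = box_volume N"
  using sum_box_prod[of "\<lambda>_ _. 1 :: real" "-N" N]
  by (simp add: box_volume_def less_eq_vec_def)

lemma sum_squares_symmetric_interval:
  "(\<Sum>x = - int m..int m. (real_of_int x)\<^sup>2) = real m * (real m + 1) * (2 * real m + 1) / 3"
proof (induction m)
  case (Suc m)
  have "{- int (Suc m)..int (Suc m)} = insert (- int (Suc m)) (insert (int (Suc m)) {- int m..int m})"
    by auto
  then show ?case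
    using Suc by (simp add: power2_eq_square field_simps)
qed simp

lemma sum_coordinate_squares_box:
  assumes "N \<ge> 0"
  shows "(\<Sum>k\<in>{-N..N}. (real_of_int (k $ j))\<^sup>2) = box_volume N * (of_int (N $ j) * (of_int (N $ j) + 1) / 3)"
proof -
  \<comment> \<open>Padding the single square with trivial factors brings it into the product form
    of \<open>sum_box_prod\<close>.\<close>
  define f :: "'a \<Rightarrow> int \<Rightarrow> real" where "f i x = (if i = j then (of_int x)\<^sup>2 else 1)" for i x
  have f: "(\<Prod>i\<in>UNIV. f i (k $ i)) = (of_int (k $ j))\<^sup>2" for k :: "int ^ 'a"
    by (simp add: f_def)
  have N: "N $ i \<ge> 0" for i
    using assms by (simp add: less_eq_vec_def)
  have "(\<Sum>k\<in>{-N..N}. (real_of_int (k $ j))\<^sup>2) = (\<Prod>i\<in>UNIV. \<Sum>x\<in>{- N $ i..N $ i}. f i x)"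
    using sum_box_prod[of f "-N" N] by (simp add: f)
  also have "\<dots> = (\<Sum>x\<in>{- N $ j..N $ j}. (of_int x)\<^sup>2) * slice_volume j N"
    using N by (subst prod.remove[of _ j]) (simp_all add: f_def slice_volume_def)
  finally show ?thesis
    using sum_squares_symmetric_interval[of "nat (N $ j)"] N[of j]
    by (simp add: box_volume_eq_slice_volume[of _ j])
qed

text \<open>The count factors over coordinates. In direction \<open>j\<close>, two equal intervals
  lose one point under the unit shift; if the lengths differ, each end leaves room for the shift and
  the shorter interval survives whole.\<close>

lemma card_box_inter_shift:
  fixes M N :: "int ^ 'd"
  assumes "M \<ge> 0" "N \<ge> 0"
  shows "(\<Sum>k\<in>{-N..N}. of_bool (k - axis j 1 \<in> {-M..M}))
    = slice_volume j (\<chi> i. min (M $ i) (N $ i)) * (2 * of_int (min (M $ j) (N $ j)) + of_bool (M $ j \<noteq> N $ j))"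
proof -
  define f :: "'d \<Rightarrow> int \<Rightarrow> real" where
    "f i x = of_bool (x - of_bool (i = j) \<in> {- M $ i..M $ i})" for i x
  have f: "(\<Prod>i\<in>UNIV. f i (k $ i)) = of_bool (k - axis j 1 \<in> {-M..M})" for k :: "int ^ 'd"
  proof -
    have "k - axis j 1 \<in> {-M..M} \<longleftrightarrow> (\<forall>i. k $ i - of_bool (i = j) \<in> {- M $ i..M $ i})"
      by (auto simp: less_eq_vec_def axis_def of_bool_def)
    then show ?thesis
      by (auto simp: f_def prod_zero_iff of_bool_def)
  qed
  have nonneg: "M $ i \<ge> 0" "N $ i \<ge> 0" for i
    using assms by (simp_all add: less_eq_vec_def)
  have *: "(\<Sum>x\<in>{- N $ i..N $ i}. f i x)
      = 2 * of_int (min (M $ i) (N $ i)) + of_bool (i \<noteq> j \<or> M $ i \<noteq> N $ i)" for i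
  proof -
    have "{- N $ i..N $ i} \<inter> {x. x - of_bool (i = j) \<in> {- M $ i..M $ i}}
        = {max (- N $ i) (- M $ i + of_bool (i = j))..min (N $ i) (M $ i + of_bool (i = j))}"
      by auto
    then show ?thesis
      using nonneg[of i] by (auto simp: f_def min_def max_def)
  qed
  have "(\<Sum>k\<in>{-N..N}. of_bool (k - axis j 1 \<in> {-M..M})) = (\<Prod>i\<in>UNIV. \<Sum>x\<in>{- N $ i..N $ i}. f i x)"
    using sum_box_prod[of f "-N" N] by (simp add: f)
  also have "\<dots> = slice_volume j (\<chi> i. min (M $ i) (N $ i))
      * (2 * of_int (min (M $ j) (N $ j)) + of_bool (M $ j \<noteq> N $ j))"
    by (subst prod.remove[of _ j]) (simp_all add: * slice_volume_def)
  finally show ?thesis .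
qed

text \<open>Exactly 2(n - m) - 1 pairs in the square of side \<open>n\<close> have minimum
  \<open>m\<close>.\<close>

lemma sum_min_square:
  fixes g :: "nat \<Rightarrow> real"
  shows "(\<Sum>m<n. \<Sum>m'<n. g (min m m')) = (\<Sum>m<n. (2 * (real n - real m) - 1) * g m)"
proof (induction n)
  case (Suc n)
  have "(\<Sum>m<Suc n. \<Sum>m'<Suc n. g (min m m'))
      = (\<Sum>m<n. \<Sum>m'<n. g (min m m')) + 2 * (\<Sum>m<n. g m) + g n"
    by (simp add: sum.distrib min_def)
  also have "\<dots> = (\<Sum>m<Suc n. (2 * (real (Suc n) - real m) - 1) * g m)"
    unfolding Suc by (simp add: algebra_simps sum.distrib sum_subtractf sum_distrib_left)
  finally show ?case .
qed simp

section \<open>The Dirichlet kernel\<close>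

text \<open>Each coordinate alone forces the bound N_i / (6 d^2); adding these up and comparing the
  Euclidean norm with the l1 norm costs another factor d.\<close>

lemma UP_GG_dirichlet_kernel_lower:
  fixes N :: "int ^ 'd"
  assumes "N > 0"
  shows "norm (real_vec N) / (6 * real CARD('d) ^ 3) \<le> UP_GG (dirichlet_kernel N)"
proof -
  let ?d = "real CARD('d)"
  define V where "V = box_volume N"
  define a where "a j = 2 * real_of_int (N $ j) / (2 * of_int (N $ j) + 1)" for j
  define b where "b = (\<Sum>j\<in>UNIV. a j)"
  define v where "v j = real_of_int (N $ j) * (of_int (N $ j) + 1) / 3" for j
  have N_ge: "N \<ge> 0"
    using assms by simp
  then have N_nonneg: "N $ j \<ge> 0" for j
    by (simp add: less_eq_vec_def)
  then have V_pos: "V > 0"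
    unfolding V_def box_volume_def by (intro prod_pos) (simp add: add_nonneg_pos)
  \<comment> \<open>One positive coordinate makes the correlation sum \<open>b\<close> positive, so
    that the uncertainty product is defined.\<close>
  obtain i where "N $ i > 0"
    using assms by (auto simp: less_vec_def less_eq_vec_def not_le)
  then have "a i > 0"
    by (simp add: a_def)
  have a_nonneg: "a j \<ge> 0" and a_le: "a j \<le> 1" for j
    using N_nonneg[of j] by (auto simp: a_def field_simps)
  have b_pos: "b > 0"
    unfolding b_def using \<open>a i > 0\<close> a_nonneg by (intro sum_pos2) auto
  have b_le: "b \<le> ?d"
    unfolding b_def using sum_bounded_above[of UNIV a 1] a_le by simp
  have v_nonneg: "v j \<ge> 0" for j
    using N_nonneg[of j] by (simp add: v_def)

  define c :: "int ^ 'd \<Rightarrow> real" where "c k = of_bool (k \<in> {-N..N})" for k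
  interpret trig_polynomial "{-N..N}" c
    by standard (auto simp: c_def finite_box)
  have poly: "poly = dirichlet_kernel N"
    unfolding poly_def dirichlet_kernel_def by (rule ext, rule sum.cong) (auto simp: c_def)
  have S: "(\<Sum>k\<in>{-N..N}. (c k)\<^sup>2) = V"
    using card_box[OF N_ge] by (simp add: c_def V_def)
  have A: "(\<Sum>k\<in>{-N..N}. c (k - axis j 1) * c k) = V * a j" for j
  proof -
    have "(\<Sum>k\<in>{-N..N}. c (k - axis j 1) * c k) = (\<Sum>k\<in>{-N..N}. of_bool (k - axis j 1 \<in> {-N..N}))"
      by (intro sum.cong) (auto simp: c_def)
    also have "\<dots> = slice_volume j N * (2 * of_int (N $ j))"
      by (subst card_box_inter_shift[OF N_ge N_ge]) simp
    also have "\<dots> = V * a j"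
      using N_nonneg[of j] by (simp add: V_def a_def box_volume_eq_slice_volume[of _ j])
    finally show ?thesis .
  qed
  have Q: "(\<Sum>k\<in>{-N..N}. (of_int (k $ j))\<^sup>2 * (c k)\<^sup>2) = V * v j" for j
  proof -
    have "(\<Sum>k\<in>{-N..N}. (of_int (k $ j))\<^sup>2 * (c k)\<^sup>2) = (\<Sum>k\<in>{-N..N}. (of_int (k $ j))\<^sup>2)"
      by (intro sum.cong) (auto simp: c_def)
    then show ?thesis
      using sum_coordinate_squares_box[OF N_ge] by (simp add: V_def v_def)
  qed
  have UP: "UP_GG (dirichlet_kernel N) = (\<Sum>j\<in>UNIV. 1 - (a j)\<^sup>2) / b\<^sup>2 * (\<Sum>j\<in>UNIV. v j)"
  proof -
    have "c (- k) = c k" "c k \<ge> 0" for k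
      by (auto simp: c_def less_eq_vec_def minus_le_iff)
    moreover have sum_A: "(\<Sum>j\<in>UNIV. V * a j) = V * b"
      by (simp add: b_def sum_distrib_left)
    moreover have "V * b \<noteq> 0"
      using V_pos b_pos by simp
    ultimately have "UP_GG (dirichlet_kernel N) =
        (\<Sum>j\<in>UNIV. V\<^sup>2 - (V * a j)\<^sup>2) / (\<Sum>j\<in>UNIV. V * a j)\<^sup>2 * (\<Sum>j\<in>UNIV. V * v j / V)"
      unfolding poly[symmetric] by (intro UP_GG_poly[unfolded S A Q]) simp_all
    also have "(\<Sum>j\<in>UNIV. V\<^sup>2 - (V * a j)\<^sup>2) = V\<^sup>2 * (\<Sum>j\<in>UNIV. 1 - (a j)\<^sup>2)"
      by (simp add: sum_distrib_left power_mult_distrib algebra_simps)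
    finally show ?thesis
      unfolding sum_A using V_pos by (simp add: power_mult_distrib)
  qed
  have lower: "of_int (N $ i) / (6 * ?d\<^sup>2) \<le> UP_GG (dirichlet_kernel N)" for i
  proof -
    define x where "x = real_of_int (N $ i)"
    have x: "x \<ge> 0"
      using N_nonneg by (simp add: x_def)
    \<comment> \<open>Since 0 \<le> a_i \<le> 1, 1 - a_i^2 = (1 - a_i)(1 + a_i) is at least 1 - a_i,
      which is the left-hand side.\<close>
    have "1 / (2 * x + 1) \<le> 1 - (a i)\<^sup>2"
      using x by (simp add: a_def x_def[symmetric] divide_simps power2_eq_square) (simp add: algebra_simps)
    also have "\<dots> \<le> (\<Sum>j\<in>UNIV. 1 - (a j)\<^sup>2)"
      using a_nonneg a_le by (intro member_le_sum) (auto intro: power_le_one)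
    finally have 1: "1 / (2 * x + 1) \<le> (\<Sum>j\<in>UNIV. 1 - (a j)\<^sup>2)" .
    have 2: "x * (x + 1) / 3 \<le> (\<Sum>j\<in>UNIV. v j)"
      using v_nonneg member_le_sum[of i UNIV v] by (simp add: v_def x_def)
    have "x / (6 * ?d\<^sup>2) = (x / 6) / ?d\<^sup>2"
      by simp
    \<comment> \<open>The constant 6 is 3 times 2, because (x + 1) / (2x + 1) is at least
      1/2.\<close>
    also have "\<dots> \<le> (1 / (2 * x + 1) * (x * (x + 1) / 3)) / ?d\<^sup>2"
      using x by (intro divide_right_mono) (simp_all add: divide_simps, simp add: algebra_simps)
    also have "\<dots> = 1 / (2 * x + 1) / ?d\<^sup>2 * (x * (x + 1) / 3)"
      by simp
    also have "\<dots> \<le> (\<Sum>j\<in>UNIV. 1 - (a j)\<^sup>2) / b\<^sup>2 * (\<Sum>j\<in>UNIV. v j)"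
      using x b_pos b_le v_nonneg a_nonneg a_le
      by (intro mult_mono frac_le 1 2 power_mono sum_nonneg divide_nonneg_nonneg)
        (auto intro: power_le_one)
    finally show ?thesis
      by (simp add: UP x_def)
  qed
  have "norm (real_vec N) \<le> (\<Sum>i\<in>UNIV. real_of_int (N $ i))"
    using norm_le_l1_cart[of "real_vec N"] N_nonneg by (simp add: real_vec_def)
  also have "\<dots> \<le> (\<Sum>i\<in>(UNIV :: 'd set). 6 * ?d\<^sup>2 * UP_GG (dirichlet_kernel N))"
    using lower by (intro sum_mono) (simp add: pos_divide_le_eq mult.commute)
  finally show ?thesis
    by (simp add: pos_divide_le_eq power2_eq_square power3_eq_cube mult_ac)
qed

section \<open>Sums of powers of odd numbers\<close>

text \<open>The difference factors as y - x times p + 1 monomials of degree \<open>p\<close>, each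
  lying between x^p and y^p.\<close>

lemma power_Suc_diff_bounds:
  fixes x y :: real
  assumes "0 \<le> x" "x \<le> y"
  shows "real (Suc p) * (y - x) * x ^ p \<le> y ^ Suc p - x ^ Suc p"
    and "y ^ Suc p - x ^ Suc p \<le> real (Suc p) * (y - x) * y ^ p"
proof -
  have eq: "y ^ Suc p - x ^ Suc p = (y - x) * (\<Sum>i<Suc p. y ^ i * x ^ (p - i))"
    by (rule diff_power_eq_sum)
  have "x ^ p \<le> y ^ i * x ^ (p - i) \<and> y ^ i * x ^ (p - i) \<le> y ^ p" if "i < Suc p" for i
  proof -
    have "x ^ i * x ^ (p - i) \<le> y ^ i * x ^ (p - i)" "y ^ i * x ^ (p - i) \<le> y ^ i * y ^ (p - i)"
      using assms by (intro mult_right_mono mult_left_mono power_mono; simp)+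
    then show ?thesis
      using that by (simp flip: power_add)
  qed
  then have "real (Suc p) * x ^ p \<le> (\<Sum>i<Suc p. y ^ i * x ^ (p - i))"
    "(\<Sum>i<Suc p. y ^ i * x ^ (p - i)) \<le> real (Suc p) * y ^ p"
    using sum_bounded_below[of "{..<Suc p}" "x ^ p" "\<lambda>i. y ^ i * x ^ (p - i)"]
      sum_bounded_above[of "{..<Suc p}" "\<lambda>i. y ^ i * x ^ (p - i)" "y ^ p"] by auto
  then have "(y - x) * (real (Suc p) * x ^ p) \<le> y ^ Suc p - x ^ Suc p"
    "y ^ Suc p - x ^ Suc p \<le> (y - x) * (real (Suc p) * y ^ p)"
    unfolding eq using assms by (intro mult_left_mono; simp)+
  then show "real (Suc p) * (y - x) * x ^ p \<le> y ^ Suc p - x ^ Suc p"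
    "y ^ Suc p - x ^ Suc p \<le> real (Suc p) * (y - x) * y ^ p"
    by (simp_all only: mult_ac)
qed

definition odd_power_sum :: "nat \<Rightarrow> nat \<Rightarrow> real" where
  "odd_power_sum p n = (\<Sum>m<n. (2 * real m + 1) ^ p)"

text \<open>Telescoping: the summand (2n + 1)^p, times 2(p + 1), is at most the increment of the (p
  + 1)-st power from 2n + 1 to 2n + 3.\<close>

lemma odd_power_sum_upper: "2 * real (Suc p) * odd_power_sum p n \<le> (2 * real n + 1) ^ Suc p"
proof (induction n)
  case (Suc n)
  then show ?case
    using power_Suc_diff_bounds(1)[of "2 * real n + 1" "2 * real (Suc n) + 1" p]
    by (simp add: odd_power_sum_def algebra_simps)
qed (simp add: odd_power_sum_def)

text \<open>Telescoping with the increment from 2n - 1 to 2n + 1. The induction starts at 1: for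
  \<open>n = 0\<close> and odd \<open>p\<close> the left side would be 1 and the right side
  0.\<close>

lemma odd_power_sum_lower:
  assumes "n > 0"
  shows "(2 * real n - 1) ^ Suc p \<le> 2 * real (Suc p) * odd_power_sum p n"
  using assms
proof (induction n rule: nat_induct_non_zero)
  case (Suc n)
  then show ?case
    using power_Suc_diff_bounds(2)[of "2 * real n - 1" "2 * real (Suc n) - 1" p]
    by (simp add: odd_power_sum_def algebra_simps)
qed (simp add: odd_power_sum_def)

lemma odd_power_sum_asymp:
  "(\<lambda>n. odd_power_sum p n / real n ^ Suc p) \<longlonglongrightarrow> 2 ^ p / real (Suc p)"
proof (rule tendsto_sandwich)
  show "\<forall>\<^sub>F n in sequentially. ((2 * real n - 1) / real n) ^ Suc p / (2 * real (Suc p))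
      \<le> odd_power_sum p n / real n ^ Suc p"
    using eventually_gt_at_top[of 0]
  proof eventually_elim
    case (elim n)
    then have "(2 * real n - 1) ^ Suc p / (2 * real (Suc p)) \<le> odd_power_sum p n"
      using odd_power_sum_lower[of n p] by (simp add: pos_divide_le_eq mult.commute del: power_Suc of_nat_Suc)
    from divide_right_mono[OF this, of "real n ^ Suc p"] show ?case
      by (simp add: power_divide mult.commute del: power_Suc of_nat_Suc)
  qed
  show "\<forall>\<^sub>F n in sequentially. odd_power_sum p n / real n ^ Suc p
      \<le> ((2 * real n + 1) / real n) ^ Suc p / (2 * real (Suc p))"
    using eventually_gt_at_top[of 0]
  proof eventually_elim
    case (elim n)
    then have "odd_power_sum p n \<le> (2 * real n + 1) ^ Suc p / (2 * real (Suc p))"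
      using odd_power_sum_upper[of p n] by (simp add: pos_le_divide_eq mult.commute del: power_Suc of_nat_Suc)
    from divide_right_mono[OF this, of "real n ^ Suc p"] show ?case
      by (simp add: power_divide mult.commute del: power_Suc of_nat_Suc)
  qed
  have lim: "(\<lambda>n. (2 * real n - 1) / real n) \<longlonglongrightarrow> 2" "(\<lambda>n. (2 * real n + 1) / real n) \<longlonglongrightarrow> 2"
    by real_asymp+
  have eq: "2 ^ Suc p / (2 * real (Suc p)) = 2 ^ p / real (Suc p)"
    by (simp del: of_nat_Suc)
  from lim[THEN tendsto_power, of "Suc p", THEN tendsto_divide[OF _ tendsto_const], of "2 * real (Suc p)"]
  show "(\<lambda>n. ((2 * real n - 1) / real n) ^ Suc p / (2 * real (Suc p))) \<longlonglongrightarrow> 2 ^ p / real (Suc p)"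
    "(\<lambda>n. ((2 * real n + 1) / real n) ^ Suc p / (2 * real (Suc p))) \<longlonglongrightarrow> 2 ^ p / real (Suc p)"
    unfolding eq by simp_all
qed

section \<open>The Fejer kernel\<close>

definition cube :: "nat \<Rightarrow> int ^ 'd" where
  "cube m = (\<chi> i. int m)"

lemma cube_nonneg: "cube m \<ge> 0"
  by (simp add: cube_def less_eq_vec_def)

lemma box_volume_cube: "box_volume (cube m :: int ^ 'd) = (2 * real m + 1) ^ CARD('d)"
  by (simp add: box_volume_def cube_def)

lemma slice_volume_cube: "slice_volume j (cube m :: int ^ 'd) = (2 * real m + 1) ^ (CARD('d) - 1)"
  by (simp add: slice_volume_def cube_def)

lemma mem_cube_iff: "k \<in> {- cube m..cube m} \<longleftrightarrow> infnorm (real_vec k) \<le> real m"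
proof -
  have "infnorm (real_vec k) \<le> real m \<longleftrightarrow> (\<forall>i. \<bar>k $ i\<bar> \<le> int m)"
  proof -
    have "\<bar>real_of_int x\<bar> \<le> real m \<longleftrightarrow> \<bar>x\<bar> \<le> int m" for x
      by linarith
    then show ?thesis
      by (auto simp: infnorm_Max Basis_vec_def inner_axis real_vec_def)
  qed
  then show ?thesis
    by (auto simp: less_eq_vec_def cube_def abs_le_iff minus_le_iff)
qed

text \<open>Integrality of the norm is what turns the linear weight of the kernel into a count of
  cubes.\<close>

lemma infnorm_real_vec_in_Nats: "infnorm (real_vec k) \<in> \<nat>"
proof -
  have "infnorm (real_vec k) \<in> (\<lambda>b. \<bar>real_vec k \<bullet> b\<bar>) ` Basis"
    unfolding infnorm_Max by (rule Max_in) auto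
  then obtain i where "infnorm (real_vec k) = \<bar>real_of_int (k $ i)\<bar>"
    by (auto simp: Basis_vec_def inner_axis real_vec_def)
  then have "infnorm (real_vec k) = real (nat \<bar>k $ i\<bar>)"
    by simp
  then show ?thesis
    by (metis of_nat_in_Nats)
qed

definition fejer_coeff :: "nat \<Rightarrow> int ^ 'd \<Rightarrow> real" where
  "fejer_coeff n k = (\<Sum>m<n. of_bool (k \<in> {- cube m..cube m})) / real n"

text \<open>A point of sup norm r lies in the cubes with r \<le> m < n, of which there are n - r
  when r < n and none otherwise.\<close>

lemma fejer_coeff_eq:
  assumes "n > 0"
  shows "fejer_coeff n k =
    (if infnorm (real_vec k) < real n then 1 - infnorm (real_vec k) / real n else 0)"
proof -
  obtain r where r: "infnorm (real_vec k) = real r"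
    using infnorm_real_vec_in_Nats[of k] by (auto elim: Nats_cases)
  have "(\<Sum>m<n. of_bool (k \<in> {- cube m..cube m}) :: real) = real (card {r..<n})"
  proof -
    have "{..<n} \<inter> {m. r \<le> m} = {r..<n}"
      by auto
    then show ?thesis
      by (simp only: mem_cube_iff r of_nat_le_iff sum_of_bool_eq finite_lessThan)
  qed
  then show ?thesis
    using assms by (auto simp: fejer_coeff_def r of_nat_diff field_simps)
qed

text \<open>Squaring the average produces pairs of nested cubes, each meeting in the smaller one.
  The weight \<open>w\<close> is 1 for the norm and the square of a coordinate for the second
  moment.\<close>

lemma sum_box_layers:
  fixes w :: "int ^ 'd \<Rightarrow> real"
  shows "(\<Sum>k\<in>{- cube n..cube n}. w k * (fejer_coeff n k)\<^sup>2)
    = (\<Sum>m<n. (2 * (real n - real m) - 1) * (\<Sum>k\<in>{- cube m..cube m}. w k)) / (real n)\<^sup>2"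
proof -
  let ?B = "\<lambda>m. {- cube m..cube m} :: (int ^ 'd) set"
  have inter: "k \<in> ?B (min m m') \<longleftrightarrow> k \<in> ?B m \<and> k \<in> ?B m'" for k m m'
    unfolding mem_cube_iff by auto
  have B_subset: "?B m \<subseteq> ?B n" if "m < n" for m
    using that unfolding subset_iff mem_cube_iff by auto
  have "(\<Sum>k\<in>?B n. w k * (fejer_coeff n k)\<^sup>2) * (real n)\<^sup>2
      = (\<Sum>k\<in>?B n. w k * ((\<Sum>m<n. of_bool (k \<in> ?B m)) * (\<Sum>m<n. of_bool (k \<in> ?B m))))"
    unfolding sum_distrib_right
    by (intro sum.cong) (auto simp: fejer_coeff_def power_divide power2_eq_square)
  also have "\<dots> = (\<Sum>k\<in>?B n. \<Sum>m<n. \<Sum>m'<n. w k * of_bool (k \<in> ?B m \<and> k \<in> ?B m'))"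
    unfolding sum_product by (simp only: sum_distrib_left of_bool_conj)
  also have "\<dots> = (\<Sum>m<n. \<Sum>m'<n. \<Sum>k\<in>?B n. w k * of_bool (k \<in> ?B m \<and> k \<in> ?B m'))"
    by (subst sum.swap, intro sum.cong refl, subst sum.swap) simp
  also have "\<dots> = (\<Sum>m<n. \<Sum>m'<n. \<Sum>k\<in>?B (min m m'). w k)"
    by (intro sum.cong refl sum.mono_neutral_cong_right)
      (auto simp: finite_box inter B_subset
        simp del: atLeastAtMost_iff atLeastatMost_subset_iff)
  also have "\<dots> = (\<Sum>m<n. (2 * (real n - real m) - 1) * (\<Sum>k\<in>?B m. w k))"
    by (rule sum_min_square)
  \<comment> \<open>For \<open>n = 0\<close> both sides are 0, by the convention for division by
    zero.\<close>
  finally show ?thesis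
    by (cases "n = 0") (auto simp: divide_simps fejer_coeff_def)
qed

text \<open>The same double sum as without the shift, except that each diagonal pair of equal cubes
  loses one slice; these losses add up to the subtracted term.\<close>

lemma sum_box_layers_shift:
  fixes j :: "'d :: finite"
  shows "(\<Sum>k\<in>{- cube n..cube n :: int ^ 'd}. fejer_coeff n (k - axis j 1) * fejer_coeff n k)
    = ((\<Sum>m<n. (2 * (real n - real m) - 1) * (2 * real m + 1) ^ CARD('d))
        - odd_power_sum (CARD('d) - 1) n) / (real n)\<^sup>2"
proof -
  let ?B = "\<lambda>m. {- cube m..cube m} :: (int ^ 'd) set"
  let ?p = "CARD('d) - 1"
  have B_subset: "?B m \<subseteq> ?B n" if "m < n" for m
    using that unfolding subset_iff mem_cube_iff by auto
  have min_cube: "(\<chi> i. min (cube m $ i) (cube m' $ i)) = (cube (min m m') :: int ^ 'd)" for m m'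
    by (simp add: cube_def vec_eq_iff min_def)
  have overlap: "(\<Sum>k\<in>?B m'. of_bool (k - axis j 1 \<in> ?B m))
      = (2 * real (min m m') + 1) ^ CARD('d) - (if m = m' then (2 * real m + 1) ^ ?p else 0)" for m m'
  proof -
    have "(2 * real (min m m') + 1) ^ CARD('d) = (2 * real (min m m') + 1) ^ ?p * (2 * real (min m m') + 1)"
      by (simp flip: power_Suc2)
    moreover have "min (cube m $ j) (cube m' $ j) = int (min m m')" "cube m $ j = cube m' $ j \<longleftrightarrow> m = m'"
      by (simp_all add: cube_def)
    ultimately show ?thesis
      by (simp add: card_box_inter_shift[OF cube_nonneg cube_nonneg] min_cube slice_volume_cube
          algebra_simps del: atLeastAtMost_iff)
  qed
  have "(\<Sum>k\<in>?B n. fejer_coeff n (k - axis j 1) * fejer_coeff n k) * (real n)\<^sup>2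
      = (\<Sum>k\<in>?B n. (\<Sum>m<n. of_bool (k - axis j 1 \<in> ?B m)) * (\<Sum>m'<n. of_bool (k \<in> ?B m')))"
    unfolding sum_distrib_right
    by (intro sum.cong) (auto simp: fejer_coeff_def power2_eq_square)
  also have "\<dots> = (\<Sum>k\<in>?B n. \<Sum>m<n. \<Sum>m'<n. of_bool (k - axis j 1 \<in> ?B m) * of_bool (k \<in> ?B m'))"
    by (simp only: sum_product)
  also have "\<dots> = (\<Sum>m<n. \<Sum>m'<n. \<Sum>k\<in>?B n. of_bool (k - axis j 1 \<in> ?B m) * of_bool (k \<in> ?B m'))"
    by (subst sum.swap, intro sum.cong refl, subst sum.swap) simp
  also have "\<dots> = (\<Sum>m<n. \<Sum>m'<n. \<Sum>k\<in>?B m'. of_bool (k - axis j 1 \<in> ?B m))"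
    using B_subset
    by (intro sum.cong refl sum.mono_neutral_cong_right) (auto simp: finite_box simp del: atLeastAtMost_iff)
  also have "\<dots> = (\<Sum>m<n. \<Sum>m'<n. (2 * real (min m m') + 1) ^ CARD('d)) - odd_power_sum ?p n"
    unfolding overlap
    by (simp add: sum_subtractf odd_power_sum_def)
  also have "(\<Sum>m<n. \<Sum>m'<n. (2 * real (min m m') + 1) ^ CARD('d))
      = (\<Sum>m<n. (2 * (real n - real m) - 1) * (2 * real m + 1) ^ CARD('d))"
    using sum_min_square[of "\<lambda>m. (2 * real m + 1) ^ CARD('d)" n] by simp
  finally show ?thesis
    by (cases "n = 0") (auto simp: divide_simps fejer_coeff_def)
qed

text \<open>With x = 2m + 1 the pair count 2(n - m) - 1 equals 2n - x, so the weighted sum of x^p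
  splits into two plain power sums.\<close>

definition weighted_odd_power_sum :: "nat \<Rightarrow> nat \<Rightarrow> real" where
  "weighted_odd_power_sum p n = 2 * real n * odd_power_sum p n - odd_power_sum (Suc p) n"

lemma weighted_odd_power_sum_eq:
  "(\<Sum>m<n. (2 * (real n - real m) - 1) * (2 * real m + 1) ^ p) = weighted_odd_power_sum p n"
  by (simp add: weighted_odd_power_sum_def odd_power_sum_def sum_distrib_left algebra_simps
      flip: sum_subtractf)

text \<open>Both parts have order n^(p+2), and their leading coefficients leave a positive
  difference.\<close>

lemma weighted_odd_power_sum_asymp:
  "(\<lambda>n. weighted_odd_power_sum p n / real n ^ (p + 2)) \<longlonglongrightarrow> 2 ^ (p + 1) / (real (p + 1) * real (p + 2))"
proof -
  have "(\<lambda>n. 2 * (odd_power_sum p n / real n ^ Suc p) - odd_power_sum (Suc p) n / real n ^ Suc (Suc p))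
      \<longlonglongrightarrow> 2 * (2 ^ p / real (Suc p)) - 2 ^ Suc p / real (Suc (Suc p))"
    by (intro tendsto_intros odd_power_sum_asymp)
  also have "2 * (2 ^ p / real (Suc p)) - 2 ^ Suc p / real (Suc (Suc p))
      = 2 ^ (p + 1) / (real (p + 1) * real (p + 2))"
    by (simp add: divide_simps) (simp add: algebra_simps)
  finally show ?thesis
  proof (rule Lim_transform_eventually)
    show "\<forall>\<^sub>F n in sequentially. 2 * (odd_power_sum p n / real n ^ Suc p)
        - odd_power_sum (Suc p) n / real n ^ Suc (Suc p) = weighted_odd_power_sum p n / real n ^ (p + 2)"
      using eventually_gt_at_top[of 0]
      by eventually_elim (simp add: weighted_odd_power_sum_def divide_simps)
  qed
qed

text \<open>All directions contribute equally, so the powers of the dimension cancel (d / d^2 times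
  d), as do the normalisations by n^2.\<close>

lemma UP_GG_fejer_kernel:
  fixes n :: nat
  defines "D \<equiv> weighted_odd_power_sum CARD('d) n"
    and "P \<equiv> odd_power_sum (CARD('d) - 1) n"
    and "E \<equiv> (weighted_odd_power_sum (CARD('d) + 2) n - weighted_odd_power_sum CARD('d) n) / 12"
  assumes n: "n > 0" and DP: "D \<noteq> P"
  shows "UP_GG (fejer_kernel n :: real ^ 'd \<Rightarrow> complex) = (D\<^sup>2 - (D - P)\<^sup>2) / (D - P)\<^sup>2 * (E / D)"
proof -
  let ?B = "{- cube n..cube n} :: (int ^ 'd) set"
  have n2: "(real n)\<^sup>2 > 0"
    using n by simp
  interpret trig_polynomial ?B "fejer_coeff n"
    by standard (auto simp: finite_box fejer_coeff_eq[OF n] mem_cube_iff simp del: atLeastAtMost_iff)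
  have poly: "poly = fejer_kernel n"
  proof
    fix x
    show "poly x = fejer_kernel n x"
      unfolding poly_def fejer_kernel_def
      by (rule sum.mono_neutral_cong_right)
        (auto simp: finite_box fejer_coeff_eq[OF n] mem_cube_iff simp del: atLeastAtMost_iff)
  qed
  have S: "(\<Sum>k\<in>?B. (fejer_coeff n k)\<^sup>2) = D / (real n)\<^sup>2"
  proof -
    have "(\<Sum>k\<in>{- cube m..cube m :: int ^ 'd}. 1 :: real) = (2 * real m + 1) ^ CARD('d)" for m
      by (simp add: card_box[OF cube_nonneg] box_volume_cube)
    then show ?thesis
      using sum_box_layers[of "\<lambda>_ :: int ^ 'd. 1" n]
      by (simp only: mult_1 weighted_odd_power_sum_eq D_def)
  qed
  have A: "(\<Sum>k\<in>?B. fejer_coeff n (k - axis j 1) * fejer_coeff n k) = (D - P) / (real n)\<^sup>2" for j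
    by (simp only: sum_box_layers_shift weighted_odd_power_sum_eq D_def P_def)
  have Q: "(\<Sum>k\<in>?B. (of_int (k $ j))\<^sup>2 * (fejer_coeff n k)\<^sup>2) = E / (real n)\<^sup>2" for j
  proof -
    \<comment> \<open>The 12 comes from m(m + 1) / 3 = ((2m + 1)^2 - 1) / 12.\<close>
    have "(\<Sum>k\<in>{- cube m..cube m :: int ^ 'd}. (real_of_int (k $ j))\<^sup>2)
        = ((2 * real m + 1) ^ (CARD('d) + 2) - (2 * real m + 1) ^ CARD('d)) / 12" for m
      unfolding sum_coordinate_squares_box[OF cube_nonneg] box_volume_cube power_add
      by (simp add: cube_def power2_eq_square algebra_simps)
    then have "(\<Sum>m<n. (2 * (real n - real m) - 1)
        * (\<Sum>k\<in>{- cube m..cube m :: int ^ 'd}. (real_of_int (k $ j))\<^sup>2)) = E"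
      unfolding E_def weighted_odd_power_sum_eq[symmetric]
      by (simp only: right_diff_distrib times_divide_eq_right sum_subtractf sum_divide_distrib diff_divide_distrib)
    then show ?thesis
      by (simp add: sum_box_layers)
  qed
  have "fejer_coeff n (- k) = fejer_coeff n k" for k :: "int ^ 'd"
    by (simp add: fejer_coeff_eq[OF n] real_vec_minus infnorm_neg)
  moreover have "fejer_coeff n k \<ge> 0" for k :: "int ^ 'd"
    unfolding fejer_coeff_def by (intro divide_nonneg_nonneg sum_nonneg) auto
  moreover have "(\<Sum>j\<in>(UNIV :: 'd set). (D - P) / (real n)\<^sup>2) \<noteq> 0"
    using DP n by simp
  ultimately have "UP_GG poly = (\<Sum>j\<in>(UNIV :: 'd set). (D / (real n)\<^sup>2)\<^sup>2 - ((D - P) / (real n)\<^sup>2)\<^sup>2)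
      / (\<Sum>j\<in>(UNIV :: 'd set). (D - P) / (real n)\<^sup>2)\<^sup>2 * (\<Sum>j\<in>(UNIV :: 'd set). E / (real n)\<^sup>2 / (D / (real n)\<^sup>2))"
    by (intro UP_GG_poly[unfolded S A Q])
  also have "\<dots> = (D\<^sup>2 - (D - P)\<^sup>2) / (D - P)\<^sup>2 * (E / D)"
    using n DP by (simp add: power_divide power_mult_distrib power2_eq_square flip: diff_divide_distrib)
  finally show ?thesis
    by (simp add: poly)
qed

text \<open>\<open>D\<close>, \<open>P\<close> and \<open>E\<close> have orders n^(d+2), n^d and
  n^(d+4). In D^2 - (D - P)^2 the leading squares cancel, so the first factor decays like n^(-2),
  which the growth of E / D balances.\<close>

lemma UP_GG_fejer_kernel_limit:
  "(\<lambda>n. UP_GG (fejer_kernel n :: real ^ 'd \<Rightarrow> complex)) \<longlonglongrightarrow>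
    (real CARD('d) + 1)\<^sup>2 * (real CARD('d) + 2)\<^sup>2
      / (6 * real CARD('d) * (real CARD('d) + 3) * (real CARD('d) + 4))"
proof -
  let ?d = "CARD('d)"
  define D where "D = weighted_odd_power_sum ?d"
  define P where "P = odd_power_sum (?d - 1)"
  define E where "E n = (weighted_odd_power_sum (?d + 2) n - weighted_odd_power_sum ?d n) / 12" for n
  define \<delta> where "\<delta> = (\<lambda>n. D n / real n ^ (?d + 2))"
  define \<pi> where "\<pi> = (\<lambda>n. P n / real n ^ ?d)"
  define \<epsilon> where "\<epsilon> = (\<lambda>n. E n / real n ^ (?d + 4))"
  define r where "r = real ?d"
  have r: "r > 0"
    by (simp add: r_def)
  have \<delta>: "\<delta> \<longlonglongrightarrow> 2 * 2 ^ ?d / ((r + 1) * (r + 2))"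
    using weighted_odd_power_sum_asymp[of ?d] by (simp add: \<delta>_def D_def r_def add_ac)
  have \<pi>: "\<pi> \<longlonglongrightarrow> 2 ^ ?d / (2 * r)"
    using odd_power_sum_asymp[of "?d - 1"]
    by (simp add: \<pi>_def P_def r_def power_diff)
  have inv: "(\<lambda>n. 1 / (real n)\<^sup>2) \<longlonglongrightarrow> 0"
    by real_asymp
  \<comment> \<open>The second part of \<open>E\<close> is smaller than the first by a factor of
    order n^2 and disappears in the limit.\<close>
  have "(\<lambda>n. (weighted_odd_power_sum (?d + 2) n / real n ^ (?d + 2 + 2) - \<delta> n * (1 / (real n)\<^sup>2)) / 12)
     \<longlonglongrightarrow> (2 ^ (?d + 2 + 1) / (real (?d + 2 + 1) * real (?d + 2 + 2))
       - 2 * 2 ^ ?d / ((r + 1) * (r + 2)) * 0) / 12"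
    by (intro tendsto_intros weighted_odd_power_sum_asymp \<delta> inv) simp
  also have "(2 ^ (?d + 2 + 1) / (real (?d + 2 + 1) * real (?d + 2 + 2))
       - 2 * 2 ^ ?d / ((r + 1) * (r + 2)) * 0) / 12 = 2 * 2 ^ ?d / (3 * ((r + 3) * (r + 4)))"
    by (simp add: r_def power_add add_ac)
  finally have \<epsilon>: "\<epsilon> \<longlonglongrightarrow> 2 * 2 ^ ?d / (3 * ((r + 3) * (r + 4)))"
    by (rule Lim_transform_eventually)
      (auto simp: \<epsilon>_def E_def \<delta>_def D_def power_add diff_divide_distrib power2_eq_square power4_eq_xxxx mult_ac
        intro!: always_eventually)
  have diff: "(\<lambda>n. \<delta> n - \<pi> n * (1 / (real n)\<^sup>2)) \<longlonglongrightarrow> 2 * 2 ^ ?d / ((r + 1) * (r + 2)) - 2 ^ ?d / (2 * r) * 0"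
    by (intro tendsto_intros \<delta> \<pi> inv)
  \<comment> \<open>\<open>X\<close> is the uncertainty product after all powers of \<open>n\<close>
    have been cancelled, leaving only convergent quantities.\<close>
  define X where "X = (\<lambda>n. \<pi> n * (2 * \<delta> n - \<pi> n * (1 / (real n)\<^sup>2)) / (\<delta> n - \<pi> n * (1 / (real n)\<^sup>2))\<^sup>2 * (\<epsilon> n / \<delta> n))"
  have "X \<longlonglongrightarrow> 2 ^ ?d / (2 * r) * (2 * (2 * 2 ^ ?d / ((r + 1) * (r + 2))) - 2 ^ ?d / (2 * r) * 0)
       / (2 * 2 ^ ?d / ((r + 1) * (r + 2)) - 2 ^ ?d / (2 * r) * 0)\<^sup>2
     * (2 * 2 ^ ?d / (3 * ((r + 3) * (r + 4))) / (2 * 2 ^ ?d / ((r + 1) * (r + 2))))"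
    unfolding X_def using r by (intro tendsto_intros \<delta> \<pi> \<epsilon> inv) auto
  also have "2 ^ ?d / (2 * r) * (2 * (2 * 2 ^ ?d / ((r + 1) * (r + 2))) - 2 ^ ?d / (2 * r) * 0)
       / (2 * 2 ^ ?d / ((r + 1) * (r + 2)) - 2 ^ ?d / (2 * r) * 0)\<^sup>2
     * (2 * 2 ^ ?d / (3 * ((r + 3) * (r + 4))) / (2 * 2 ^ ?d / ((r + 1) * (r + 2))))
     = (r + 1)\<^sup>2 * (r + 2)\<^sup>2 / (6 * r * (r + 3) * (r + 4))"
    using r by (simp add: divide_simps power2_eq_square)
  finally have "X \<longlonglongrightarrow> (r + 1)\<^sup>2 * (r + 2)\<^sup>2 / (6 * r * (r + 3) * (r + 4))" .
  moreover have "\<forall>\<^sub>F n in sequentially. X n = UP_GG (fejer_kernel n :: real ^ 'd \<Rightarrow> complex)"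
  proof -
    \<comment> \<open>The limit in \<open>diff\<close> is positive, which eventually gives
      \<open>D n \<noteq> P n\<close> and hence definedness.\<close>
    have "\<forall>\<^sub>F n in sequentially. \<delta> n - \<pi> n * (1 / (real n)\<^sup>2) \<noteq> 0"
      using r by (intro tendsto_imp_eventually_ne[OF diff]) simp
    then show ?thesis
      using eventually_gt_at_top[of 0]
    proof eventually_elim
      case (elim n)
      define q where "q = real n"
      have q: "q > 0"
        using elim by (simp add: q_def)
      have D: "D n = \<delta> n * q ^ ?d * q\<^sup>2" and P: "P n = \<pi> n * q ^ ?d" and E: "E n = \<epsilon> n * q ^ ?d * q ^ 4"
        using q by (simp_all add: \<delta>_def \<pi>_def \<epsilon>_def q_def power_add power2_eq_square)
      define u where "u = \<delta> n - \<pi> n * (1 / q\<^sup>2)"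
      define v where "v = 2 * \<delta> n - \<pi> n * (1 / q\<^sup>2)"
      have DP: "D n - P n = u * q ^ ?d * q\<^sup>2"
        using q by (simp add: D P u_def algebra_simps)
      then have "D n \<noteq> P n"
        using elim q by (auto simp: q_def u_def)
      then have "UP_GG (fejer_kernel n :: real ^ 'd \<Rightarrow> complex)
          = ((D n)\<^sup>2 - (D n - P n)\<^sup>2) / (D n - P n)\<^sup>2 * (E n / D n)"
        using UP_GG_fejer_kernel[where 'd = 'd] elim by (simp add: D_def P_def E_def)
      \<comment> \<open>Factoring carries out the cancellation of the leading squares before
        normalising.\<close>
      also have "(D n)\<^sup>2 - (D n - P n)\<^sup>2 = P n * (2 * D n - P n)"
        by (simp add: power2_eq_square algebra_simps)
      also have "2 * D n - P n = v * q ^ ?d * q\<^sup>2"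
        using q by (simp add: D P v_def algebra_simps)
      also have "P n * (v * q ^ ?d * q\<^sup>2) / (D n - P n)\<^sup>2 * (E n / D n) = X n"
        unfolding DP unfolding P D E X_def q_def[symmetric] u_def[symmetric] v_def[symmetric] using q
        by (simp add: power_mult_distrib) (simp add: power2_eq_square power4_eq_xxxx)
      finally show ?case
        by simp
    qed
  qed
  ultimately show ?thesis
    unfolding r_def by (rule Lim_transform_eventually)
qed

section \<open>Both limits combined\<close>

theorem lemma6:
  shows "filterlim (\<lambda>N :: int ^ 'd. UP_GG (dirichlet_kernel N)) at_top
           ((\<lambda>N. norm (real_vec N)) going_to at_top within {N. N > 0})
    \<and> (\<lambda>n. UP_GG (fejer_kernel n :: real ^ 'd \<Rightarrow> complex)) \<longlonglongrightarrow>
           (real CARD('d) + 1)\<^sup>2 * (real CARD('d) + 2)\<^sup>2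
             / (6 * real CARD('d) * (real CARD('d) + 3) * (real CARD('d) + 4))"
proof
  let ?F = "(\<lambda>N :: int ^ 'd. norm (real_vec N)) going_to at_top within {N. N > 0}"
  have "filterlim (\<lambda>N :: int ^ 'd. 1 / (6 * real CARD('d) ^ 3) * norm (real_vec N)) at_top ?F"
    by (rule filterlim_tendsto_pos_mult_at_top[OF tendsto_const]) auto
  \<comment> \<open>The lower bound holds for every \<open>N > 0\<close>, so any threshold on the
    norm will do.\<close>
  moreover have "\<forall>\<^sub>F N :: int ^ 'd in ?F. 1 / (6 * real CARD('d) ^ 3) * norm (real_vec N) \<le> UP_GG (dirichlet_kernel N)"
    unfolding eventually_going_to_at_top_linorder using UP_GG_dirichlet_kernel_lower by auto
  ultimately show "filterlim (\<lambda>N :: int ^ 'd. UP_GG (dirichlet_kernel N)) at_top ?F"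
    by (rule filterlim_at_top_mono)
qed (rule UP_GG_fejer_kernel_limit)

end
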